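(* Let $$C=\begin{bmatrix} 6 & 0 \\ 0 & -1\end{bmatrix}, \qquad D=\begin{bmatrix} -1.97035 & 1.72243 \\ 1.72243 & 1.79035 \end{bmatrix}.$$ Then there exists $p\in[1,2]$ such that $$\|C+D\|_p^p+\|C-D\|_p^p\;<\;\|\sigma_\downarrow(C)+\sigma_\downarrow(D)\|_p^p+\|\sigma_\downarrow(C)-\sigma_\downarrow(D)\|_p^p,$$ and there exists $p\in[2,3]$ such that $$\|C+D\|_p^p+\|C-D\|_p^p\;<\;\|\sigma_\uparrow(C)+\sigma_\downarrow(D)\|_p^p+\|\sigma_\uparrow(C)-\sigma_\downarrow(D)\|_p^p.$$ Consequently $C,D$ are a counterexample to both of the following conjectures: (1) for all $n\times n$ complex matrices $A,B$, $\|A+B\|_p^p+\|A-B\|_p^p\geq \|\sigma_\downarrow(A)+\sigma_\downarrow(B)\|_p^p+\|\sigma_\downarrow(A)-\sigma_\downarrow(B)\|_p^p$ for $1\leq p\leq 2$, with the reverse inequality for $p>2$; (2) for all $n\times n$ complex matrices $A,B$, $\|A+B\|_p^p+\|A-B\|_p^p\leq \|\sigma_\uparrow(A)+\sigma_\downarrow(B)\|_p^p+\|\sigma_\uparrow(A)-\sigma_\downarrow(B)\|_p^p$ for $1\leq p\leq 2$, with the reverse inequality for $p>2$.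
   Context: For a matrix $X\in M_{n\times n}(\mathbb{C})$, $\|X\|_p=\operatorname{Tr}[(X^*X)^{p/2}]^{1/p}$ is the $p$-Schatten norm; for a vector $v\in\mathbb{R}^n$, $\|v\|_p=(\sum_i|v_i|^p)^{1/p}$. $\sigma_\downarrow(X)$ and $\sigma_\uparrow(X)$ denote the vectors in $\mathbb{R}^n$ of singular values of $X$ (with multiplicity) in decreasing and increasing order respectively. The decimal entries of $D$ are exact. *)

theory Defs
  imports Complex_Main "HOL-Library.Multiset" "Jordan_Normal_Form.Schur_Decomposition"
begin

definition mat_trace :: "'a::comm_monoid_add mat \<Rightarrow> 'a" where
  "mat_trace A = (\<Sum>i<dim_row A. A $$ (i, i))"

(* Real powers of a positive semidefinite matrix by the spectral functional calculus: the result
   does not depend on the choice of the unitary diagonalization. *)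
definition psd_powr :: "complex mat \<Rightarrow> real \<Rightarrow> complex mat" where
  "psd_powr A s = (let n = dim_row A in
     THE Y. \<exists>U d. U \<in> carrier_mat n n \<and> mat_adjoint U * U = 1\<^sub>m n \<and> (\<forall>i<n. 0 \<le> d i) \<and>
       A = U * mat_diag n (\<lambda>i. complex_of_real (d i)) * mat_adjoint U \<and>
       Y = U * mat_diag n (\<lambda>i. complex_of_real (d i powr s)) * mat_adjoint U)"

(* The trace is a nonnegative real number, so taking its real part loses nothing. *)
definition schatten_norm :: "real \<Rightarrow> complex mat \<Rightarrow> real" where
  "schatten_norm p X = Re (mat_trace (psd_powr (mat_adjoint X * X) (p / 2))) powr (1 / p)"

definition vec_lp_norm :: "real \<Rightarrow> real vec \<Rightarrow> real" where
  "vec_lp_norm p v = (\<Sum>i<dim_vec v. \<bar>v $ i\<bar> powr p) powr (1 / p)"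

(* Square roots of the eigenvalues of X* X, with algebraic multiplicity; these eigenvalues are
   real and nonnegative, which justifies the real part. *)
definition singular_values :: "complex mat \<Rightarrow> real multiset" where
  "singular_values X = image_mset (\<lambda>z. sqrt (Re z)) (proots (char_poly (mat_adjoint X * X)))"

definition sigma_up :: "complex mat \<Rightarrow> real vec" where
  "sigma_up X = vec_of_list (sorted_list_of_multiset (singular_values X))"

definition sigma_down :: "complex mat \<Rightarrow> real vec" where
  "sigma_down X = vec_of_list (rev (sorted_list_of_multiset (singular_values X)))"

definition schatten_side :: "real \<Rightarrow> complex mat \<Rightarrow> complex mat \<Rightarrow> real" where
  "schatten_side p A B = schatten_norm p (A + B) powr p + schatten_norm p (A - B) powr p"

definition down_down_side :: "real \<Rightarrow> complex mat \<Rightarrow> complex mat \<Rightarrow> real" where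
  "down_down_side p A B =
     vec_lp_norm p (sigma_down A + sigma_down B) powr p +
     vec_lp_norm p (sigma_down A - sigma_down B) powr p"

definition up_down_side :: "real \<Rightarrow> complex mat \<Rightarrow> complex mat \<Rightarrow> real" where
  "up_down_side p A B =
     vec_lp_norm p (sigma_up A + sigma_down B) powr p +
     vec_lp_norm p (sigma_up A - sigma_down B) powr p"

definition conjecture1_for :: "complex mat \<Rightarrow> complex mat \<Rightarrow> bool" where
  "conjecture1_for A B \<longleftrightarrow>
     (\<forall>p. 1 \<le> p \<and> p \<le> 2 \<longrightarrow> schatten_side p A B \<ge> down_down_side p A B) \<and>
     (\<forall>p>2. schatten_side p A B \<le> down_down_side p A B)"

definition conjecture2_for :: "complex mat \<Rightarrow> complex mat \<Rightarrow> bool" where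
  "conjecture2_for A B \<longleftrightarrow>
     (\<forall>p. 1 \<le> p \<and> p \<le> 2 \<longrightarrow> schatten_side p A B \<le> up_down_side p A B) \<and>
     (\<forall>p>2. schatten_side p A B \<ge> up_down_side p A B)"

definition conjecture1 :: bool where
  "conjecture1 \<longleftrightarrow> (\<forall>n. \<forall>A \<in> carrier_mat n n. \<forall>B \<in> carrier_mat n n. conjecture1_for A B)"

definition conjecture2 :: bool where
  "conjecture2 \<longleftrightarrow> (\<forall>n. \<forall>A \<in> carrier_mat n n. \<forall>B \<in> carrier_mat n n. conjecture2_for A B)"

end

(*
For a Hermitian matrix with eigenvalues l_i both the p-th power of the Schatten norm and the singular
values only involve |l_i|, and the eigenvalues of C, D, C + D and C - D are of the form u + v and
u - v with u rational and v a square root of a rational.  The exponents p = 1 and p = 3 then suffice: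
there all absolute values have known signs, so both sides are polynomials in these square roots.
*)
theory Submission
  imports Defs
begin

section \<open>Adjoints, unitary matrices and the spectral functional calculus\<close>

lemma mat_adjoint_carrier [simp]:
  "A \<in> carrier_mat n m \<Longrightarrow> mat_adjoint A \<in> carrier_mat m n"
  unfolding mat_adjoint_def by auto

lemma mat_adjoint_dim [simp]:
  "dim_row (mat_adjoint A) = dim_col A" "dim_col (mat_adjoint A) = dim_row A"
  unfolding mat_adjoint_def by auto

lemma mat_adjoint_index:
  fixes A :: "complex mat"
  assumes "A \<in> carrier_mat n m" "i < m" "j < n"
  shows "mat_adjoint A $$ (i, j) = cnj (A $$ (j, i))"
  using assms unfolding mat_adjoint_def by (auto simp: mat_of_rows_def)

lemma unitary_right_inverse:
  fixes U :: "complex mat"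
  assumes "U \<in> carrier_mat n n" "mat_adjoint U * U = 1\<^sub>m n"
  shows "U * mat_adjoint U = 1\<^sub>m n"
  using mat_mult_left_right_inverse[OF mat_adjoint_carrier[OF assms(1)] assms] .

lemma spectral_mult:
  fixes U :: "complex mat"
  assumes U: "U \<in> carrier_mat n n" and unit: "mat_adjoint U * U = 1\<^sub>m n"
  shows "(U * mat_diag n f * mat_adjoint U) * (U * mat_diag n g * mat_adjoint U)
    = U * mat_diag n (\<lambda>i. f i * g i) * mat_adjoint U"
proof -
  define V where "V = mat_adjoint U"
  have V': "V \<in> carrier_mat n n" using U by (simp add: V_def)
  have "(U * mat_diag n f * V) * (U * mat_diag n g * V)
    = U * mat_diag n f * (V * U) * mat_diag n g * V"
    using U V' by (simp add: assoc_mult_mat[of _ n n _ n _ n] mult_carrier_mat[of _ n n _ n])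
  also have "\<dots> = U * mat_diag n (\<lambda>i. f i * g i) * V"
    using U V' unit[folded V_def]
    by (simp add: assoc_mult_mat[of _ n n _ n _ n] mult_carrier_mat[of _ n n _ n]
        left_mult_one_mat[of _ n n] flip: mat_diag_diag)
  finally show ?thesis by (simp add: V_def)
qed

text \<open>This makes the functional calculus independent of the diagonalization. The change of
  basis \<open>W = V' * U\<close> intertwines the two diagonal matrices, so an entry of
  \<open>W\<close> can be nonzero only where the two eigenvalues agree, and there their images under
  \<open>f\<close> agree as well. Hence \<open>W\<close> also intertwines the diagonals of the
  values of \<open>f\<close>.\<close>

lemma spectral_calculus_unique:
  fixes U V :: "complex mat" and d e :: "nat \<Rightarrow> real"
  assumes U: "U \<in> carrier_mat n n" "mat_adjoint U * U = 1\<^sub>m n"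
    and V: "V \<in> carrier_mat n n" "mat_adjoint V * V = 1\<^sub>m n"
    and eq: "U * mat_diag n (\<lambda>i. complex_of_real (d i)) * mat_adjoint U
           = V * mat_diag n (\<lambda>i. complex_of_real (e i)) * mat_adjoint V"
  shows "U * mat_diag n (\<lambda>i. complex_of_real (f (d i))) * mat_adjoint U
       = V * mat_diag n (\<lambda>i. complex_of_real (f (e i))) * mat_adjoint V"
proof -
  define U' where "U' = mat_adjoint U"
  define V' where "V' = mat_adjoint V"
  have U': "U' \<in> carrier_mat n n" "U' * U = 1\<^sub>m n" "U * U' = 1\<^sub>m n"
    using U unitary_right_inverse[OF U] by (auto simp: U'_def)
  have V': "V' \<in> carrier_mat n n" "V' * V = 1\<^sub>m n" "V * V' = 1\<^sub>m n"
    using V unitary_right_inverse[OF V] by (auto simp: V'_def)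
  define W where "W = V' * U"
  have W: "W \<in> carrier_mat n n" using U V' by (auto simp: W_def)
  note ass = assoc_mult_mat[of _ n n _ n _ n] mult_carrier_mat[of _ n n _ n]
  define Dd where "Dd = mat_diag n (\<lambda>i. complex_of_real (d i))"
  define De where "De = mat_diag n (\<lambda>i. complex_of_real (e i))"
  define Fd where "Fd = mat_diag n (\<lambda>i. complex_of_real (f (d i)))"
  define Fe where "Fe = mat_diag n (\<lambda>i. complex_of_real (f (e i)))"
  have carr: "Dd \<in> carrier_mat n n" "De \<in> carrier_mat n n" "Fd \<in> carrier_mat n n" "Fe \<in> carrier_mat n n"
    by (auto simp: Dd_def De_def Fd_def Fe_def)
  have "W * Dd = V' * (U * Dd * U') * U"
    using U U' V' carr by (simp add: W_def ass)
  also have "\<dots> = V' * (V * De * V') * U"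
    using eq by (simp add: U'_def V'_def Dd_def De_def)
  also have "\<dots> = (V' * V) * De * W"
    using U V V'(1) carr by (simp add: W_def ass)
  also have "\<dots> = De * W" using V' carr W by simp
  finally have comm: "W * Dd = De * W" .
  have comm_f: "W * Fd = Fe * W"
  proof (rule eq_matI)
    fix i j assume ij: "i < dim_row (Fe * W)" "j < dim_col (Fe * W)"
    then have ij: "i < n" "j < n" using W carr by auto
    have "(W * Dd) $$ (i, j) = (De * W) $$ (i, j)" using comm by simp
    \<comment> \<open>Compared entrywise, the intertwining relation leaves only two cases: a zero
      entry of \<open>W\<close>, or equal eigenvalues.\<close>
    then have "W $$ (i, j) * d j = e i * W $$ (i, j)"
      using ij by (simp add: Dd_def De_def mat_diag_mult_left[OF W] mat_diag_mult_right[OF W])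
    then have "W $$ (i, j) = 0 \<or> d j = e i" by auto
    then show "(W * Fd) $$ (i, j) = (Fe * W) $$ (i, j)"
      using ij by (auto simp: Fd_def Fe_def mat_diag_mult_left[OF W] mat_diag_mult_right[OF W])
  qed (use W carr in auto)
  \<comment> \<open>Inserting \<open>V * V'\<close> writes \<open>U\<close> as \<open>V * W\<close>,
    so that \<open>comm_f\<close> applies.\<close>
  have "U * Fd * U' = (V * V') * U * Fd * U'" using V' U by simp
  also have "\<dots> = V * (W * Fd) * U'"
    using U U'(1) V V'(1) carr by (simp add: W_def ass)
  also have "\<dots> = V * Fe * V' * (U * U')"
    using U U'(1) V V'(1) carr unfolding comm_f by (simp add: W_def ass)
  also have "\<dots> = V * Fe * V'" using U' V V' carr by (simp add: ass)
  finally show ?thesis by (simp add: Fd_def Fe_def U'_def V'_def)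
qed

text \<open>Evaluates the definite description in \<open>psd_powr\<close>: the given diagonalization
  is a witness, and \<open>spectral_calculus_unique\<close> for the function \<open>x powr s\<close>
  shows that every other diagonalization yields the same matrix.\<close>

lemma psd_powr_eq:
  fixes U :: "complex mat"
  assumes U: "U \<in> carrier_mat n n" "mat_adjoint U * U = 1\<^sub>m n"
    and d: "\<And>i. i < n \<Longrightarrow> 0 \<le> d i"
    and A: "A = U * mat_diag n (\<lambda>i. complex_of_real (d i)) * mat_adjoint U"
  shows "psd_powr A s = U * mat_diag n (\<lambda>i. complex_of_real (d i powr s)) * mat_adjoint U"
proof -
  have n: "dim_row A = n" using U A by simp
  show ?thesis
    unfolding psd_powr_def Let_def n
  proof (rule the_equality)
    fix Y
    assume "\<exists>V e. V \<in> carrier_mat n n \<and> mat_adjoint V * V = 1\<^sub>m n \<and> (\<forall>i<n. 0 \<le> e i) \<and>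
       A = V * mat_diag n (\<lambda>i. complex_of_real (e i)) * mat_adjoint V \<and>
       Y = V * mat_diag n (\<lambda>i. complex_of_real (e i powr s)) * mat_adjoint V"
    then obtain V e where V: "V \<in> carrier_mat n n" "mat_adjoint V * V = 1\<^sub>m n"
      and "A = V * mat_diag n (\<lambda>i. complex_of_real (e i)) * mat_adjoint V"
      and Y: "Y = V * mat_diag n (\<lambda>i. complex_of_real (e i powr s)) * mat_adjoint V" by blast
    with A show "Y = U * mat_diag n (\<lambda>i. complex_of_real (d i powr s)) * mat_adjoint U"
      using spectral_calculus_unique[OF U V, of d e "\<lambda>x. x powr s"] by simp
  qed (use U d A in blast)
qed

section \<open>Schatten norms and singular values of Hermitian matrices from their
  eigenvalues\<close>

lemma trace_unitary_diag:
  fixes U :: "complex mat"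
  assumes U: "U \<in> carrier_mat n n" "mat_adjoint U * U = 1\<^sub>m n"
  shows "mat_trace (U * mat_diag n f * mat_adjoint U) = (\<Sum>i<n. f i)"
proof -
  have V: "mat_adjoint U \<in> carrier_mat n n" using U by simp
  \<comment> \<open>The diagonal of \<open>mat_adjoint U * U\<close> says that the columns of
    \<open>U\<close> are unit vectors. Once the sums in the trace are swapped, each
    \<open>f j\<close> is multiplied by the squared norm of column \<open>j\<close>.\<close>
  have col: "(\<Sum>i<n. cnj (U $$ (i, j)) * U $$ (i, j)) = 1" if j: "j < n" for j
  proof -
    have "(mat_adjoint U * U) $$ (j, j) = (\<Sum>i<n. cnj (U $$ (i, j)) * U $$ (i, j))"
      using U(1) V j by (simp add: scalar_prod_def mat_adjoint_index[OF U(1)] atLeast0LessThan)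
    then show ?thesis using U j by simp
  qed
  have "mat_trace (U * mat_diag n f * mat_adjoint U)
      = (\<Sum>i<n. \<Sum>j<n. U $$ (i, j) * f j * cnj (U $$ (i, j)))"
    unfolding mat_trace_def mat_diag_mult_right[OF U(1)]
    using U(1) V by (simp add: scalar_prod_def mat_adjoint_index[OF U(1)] atLeast0LessThan)
  also have "\<dots> = (\<Sum>j<n. f j * (\<Sum>i<n. cnj (U $$ (i, j)) * U $$ (i, j)))"
    unfolding sum_distrib_left by (subst sum.swap) (simp add: mult_ac)
  also have "\<dots> = (\<Sum>j<n. f j)" using col by simp
  finally show ?thesis .
qed

lemma gram_hermitian_diag:
  fixes U :: "complex mat" and l :: "nat \<Rightarrow> real"
  assumes U: "U \<in> carrier_mat n n" "mat_adjoint U * U = 1\<^sub>m n"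
    and X: "X = U * mat_diag n (\<lambda>i. complex_of_real (l i)) * mat_adjoint U"
    and herm: "mat_adjoint X = X"
  shows "mat_adjoint X * X = U * mat_diag n (\<lambda>i. complex_of_real ((l i)\<^sup>2)) * mat_adjoint U"
  unfolding herm by (subst (1 2) X) (simp add: spectral_mult[OF U] power2_eq_square)

text \<open>The Gram matrix has the eigenvalues \<open>(l i)^2\<close> in the same basis, and their
  powers with exponent p/2 are those of the moduli with exponent p. The outer powers 1/p and p
  cancel because \<open>p\<close> is nonzero.\<close>

lemma schatten_norm_hermitian:
  fixes U :: "complex mat" and l :: "nat \<Rightarrow> real"
  assumes U: "U \<in> carrier_mat n n" "mat_adjoint U * U = 1\<^sub>m n"
    and X: "X = U * mat_diag n (\<lambda>i. complex_of_real (l i)) * mat_adjoint U"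
    and herm: "mat_adjoint X = X" and p: "p \<noteq> 0"
  shows "schatten_norm p X powr p = (\<Sum>i<n. \<bar>l i\<bar> powr p)"
proof -
  have sq: "(l i)\<^sup>2 powr (p / 2) = \<bar>l i\<bar> powr p" for i
  proof -
    \<comment> \<open>With the square rewritten as a \<open>powr\<close> of the modulus, the
      exponents multiply; this covers a zero eigenvalue too, since \<open>powr\<close> with base 0
      is 0.\<close>
    have "(l i)\<^sup>2 powr (p / 2) = (\<bar>l i\<bar> powr 2) powr (p / 2)" by simp
    then show ?thesis by (simp only: powr_powr) simp
  qed
  have "Re (mat_trace (psd_powr (mat_adjoint X * X) (p / 2))) = (\<Sum>i<n. \<bar>l i\<bar> powr p)"
    unfolding psd_powr_eq[OF U _ gram_hermitian_diag[OF U X herm], simplified] trace_unitary_diag[OF U]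
    by (simp add: sq)
  then show ?thesis
    using p by (simp add: schatten_norm_def powr_powr sum_nonneg)
qed

text \<open>The Gram matrix is similar to the diagonal matrix \<open>E\<close> of the squared
  eigenvalues, so its characteristic polynomial splits into the corresponding linear factors; the
  square roots of the roots are the moduli.\<close>

lemma singular_values_hermitian:
  fixes U :: "complex mat" and l :: "nat \<Rightarrow> real"
  assumes U: "U \<in> carrier_mat n n" "mat_adjoint U * U = 1\<^sub>m n"
    and X: "X = U * mat_diag n (\<lambda>i. complex_of_real (l i)) * mat_adjoint U"
    and herm: "mat_adjoint X = X"
  shows "singular_values X = mset (map (\<lambda>i. \<bar>l i\<bar>) [0..<n])"
proof -
  define E where "E = mat_diag n (\<lambda>i. complex_of_real ((l i)\<^sup>2))"
  have G: "mat_adjoint X * X = U * E * mat_adjoint U"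
    using gram_hermitian_diag[OF U X herm] by (simp add: E_def)
  have "similar_mat (mat_adjoint X * X) E"
    using U unitary_right_inverse[OF U]
    by (intro similar_matI[of _ _ U "mat_adjoint U" n]) (auto simp: G E_def intro!: mult_carrier_mat[of _ n n _ n])
  then have "char_poly (mat_adjoint X * X) = char_poly E" by (rule char_poly_similar)
  also have "\<dots> = (\<Prod>a \<leftarrow> diag_mat E. [:- a, 1:])"
    by (rule char_poly_upper_triangular[of _ n]) (auto simp: E_def mat_diag_def)
  also have "diag_mat E = map (\<lambda>i. complex_of_real ((l i)\<^sup>2)) [0..<n]"
    by (auto simp: diag_mat_def E_def mat_diag_def)
  finally have cp: "char_poly (mat_adjoint X * X)
    = (\<Prod>a \<leftarrow> map (\<lambda>i. complex_of_real ((l i)\<^sup>2)) [0..<n]. [:- a, 1:])" .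
  have roots: "proots (\<Prod>a \<leftarrow> as. [:- a, 1:]) = mset as" for as :: "complex list"
  proof (induction as)
    case (Cons a as)
    \<comment> \<open>\<open>proots\<close> turns a product into a sum of multisets only when the
      product is nonzero.\<close>
    have "(\<Prod>a \<leftarrow> as. [:- a, 1:]) \<noteq> (0 :: complex poly)" by (auto simp: prod_list_zero_iff)
    with Cons show ?case by (simp add: proots_mult del: mult_pCons_left)
  qed simp
  show ?thesis unfolding singular_values_def cp roots by (simp add: multiset.map_comp comp_def)
qed

section \<open>Diagonalization of real symmetric 2 by 2 matrices\<close>

lemma unit_eigenvector_2:
  fixes a b d l :: real
  assumes ev: "(a - l) * (d - l) = b\<^sup>2"
  obtains c s where "c\<^sup>2 + s\<^sup>2 = 1" "a * c + b * s = l * c" "b * c + d * s = l * s"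
proof (cases "b = 0 \<and> l = a")
  case True
  then show ?thesis using that[of 1 0] by simp
next
  case False
  define n where "n = sqrt (b\<^sup>2 + (l - a)\<^sup>2)"
  have pos: "b\<^sup>2 + (l - a)\<^sup>2 > 0" using False by (auto simp: sum_power2_gt_zero_iff)
  then have n: "n > 0" "n\<^sup>2 = b\<^sup>2 + (l - a)\<^sup>2" by (auto simp: n_def)
  show ?thesis
  \<comment> \<open>The vector (b, l - a) solves the first eigenvector equation identically, and the
    second one is the characteristic equation \<open>ev\<close>. It vanishes only in the case
    already treated, where the first basis vector serves.\<close>
  proof (rule that[of "b / n" "(l - a) / n"])
    show "(b / n)\<^sup>2 + ((l - a) / n)\<^sup>2 = 1"
      using n(1) by (simp add: power_divide n(2)[symmetric] flip: add_divide_distrib)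
    show "a * (b / n) + b * ((l - a) / n) = l * (b / n)"
      using n by (simp add: field_simps)
    have "b * b + d * (l - a) = l * (l - a)" using ev by (simp add: power2_eq_square algebra_simps)
    then show "b * (b / n) + d * ((l - a) / n) = l * ((l - a) / n)"
      using n by (simp add: field_simps)
  qed
qed

abbreviation sym_mat2 :: "real \<Rightarrow> real \<Rightarrow> real \<Rightarrow> complex mat" where
  "sym_mat2 a b d \<equiv> mat_of_rows_list 2
     [[complex_of_real a, complex_of_real b], [complex_of_real b, complex_of_real d]]"

lemma mat_of_rows_list_2_carrier: "mat_of_rows_list 2 [[a, b], [c, d]] \<in> carrier_mat 2 2"
  by (rule carrier_matI) (simp_all add: mat_of_rows_list_def)

lemma mat_of_rows_list_2_index [simp]:
  "mat_of_rows_list 2 [[a, b], [c, d]] $$ (0, 0) = a"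
  "mat_of_rows_list 2 [[a, b], [c, d]] $$ (0, Suc 0) = b"
  "mat_of_rows_list 2 [[a, b], [c, d]] $$ (Suc 0, 0) = c"
  "mat_of_rows_list 2 [[a, b], [c, d]] $$ (Suc 0, Suc 0) = d"
  by (simp_all add: mat_of_rows_list_def)

lemma eq_mat_2I:
  assumes "A \<in> carrier_mat 2 2" "B \<in> carrier_mat 2 2"
    and "A $$ (0, 0) = B $$ (0, 0)" "A $$ (0, Suc 0) = B $$ (0, Suc 0)"
    and "A $$ (Suc 0, 0) = B $$ (Suc 0, 0)" "A $$ (Suc 0, Suc 0) = B $$ (Suc 0, Suc 0)"
  shows "A = B"
  using assms by (intro eq_matI) (auto dest!: less_2_cases)

lemma sym_mat2_adjoint: "mat_adjoint (sym_mat2 a b d) = sym_mat2 a b d"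
  by (rule eq_mat_2I)
    (simp_all add: mat_adjoint_index[OF mat_of_rows_list_2_carrier] mat_of_rows_list_2_carrier)

text \<open>The trace and determinant conditions say that \<open>l\<close> and \<open>m\<close> are
  the two eigenvalues. The first column of the rotation \<open>U\<close> is a unit eigenvector for
  \<open>l\<close>; the second is its perpendicular, which belongs to \<open>m\<close> because
  \<open>m\<close> is the trace minus \<open>l\<close>.\<close>

lemma sym_mat2_diagonalization:
  assumes tr: "l + m = a + d" and det: "l * m = a * d - b\<^sup>2"
  obtains U where "U \<in> carrier_mat 2 2" "mat_adjoint U * U = 1\<^sub>m 2"
    "sym_mat2 a b d = U * mat_diag 2 (\<lambda>i. complex_of_real (if i = 0 then l else m)) * mat_adjoint U"
proof -
  have m: "m = a + d - l" using tr by simp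
  have "(a - l) * (d - l) = b\<^sup>2" using det unfolding m by (simp add: algebra_simps)
  then obtain c s where cs: "c\<^sup>2 + s\<^sup>2 = 1" and e1: "a * c + b * s = l * c"
    and e2: "b * c + d * s = l * s" by (rule unit_eigenvector_2)
  define U where "U = mat_of_rows_list 2
    [[complex_of_real c, complex_of_real (- s)], [complex_of_real s, complex_of_real c]]"
  have U: "U \<in> carrier_mat 2 2"
    unfolding U_def by (rule mat_of_rows_list_2_carrier)
  have V: "mat_adjoint U \<in> carrier_mat 2 2" using U by simp
  have ent: "U $$ (0, 0) = of_real c" "U $$ (0, Suc 0) = of_real (- s)"
    "U $$ (Suc 0, 0) = of_real s" "U $$ (Suc 0, Suc 0) = of_real c"
    by (auto simp: U_def)
  \<comment> \<open>\<open>m1\<close>, \<open>m2\<close> and \<open>m3\<close> identify the entries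
    of the product of \<open>U\<close>, the diagonal matrix and the adjoint of
    \<open>U\<close>.\<close>
  have m1: "l * c\<^sup>2 + m * s\<^sup>2 = a"
  proof -
    have "l * c\<^sup>2 + m * s\<^sup>2 = (l * c) * c + (a + d) * s\<^sup>2 - (l * s) * s"
      by (simp add: algebra_simps power2_eq_square flip: tr)
    also have "\<dots> = a * (c\<^sup>2 + s\<^sup>2)"
      unfolding e1[symmetric] e2[symmetric] by (simp add: algebra_simps power2_eq_square)
    finally show ?thesis using cs by simp
  qed
  have m2: "(l - m) * c * s = b"
  proof -
    have "(l - m) * c * s = (l * c) * s + (l * s) * c - (a + d) * c * s"
      by (simp add: algebra_simps flip: tr)
    also have "\<dots> = b * (c\<^sup>2 + s\<^sup>2)"
      unfolding e1[symmetric] e2[symmetric] by (simp add: algebra_simps power2_eq_square)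
    finally show ?thesis using cs by simp
  qed
  have m3: "l * s\<^sup>2 + m * c\<^sup>2 = d"
  proof -
    have "l * s\<^sup>2 + m * c\<^sup>2 = (l + m) * (c\<^sup>2 + s\<^sup>2) - (l * c\<^sup>2 + m * s\<^sup>2)"
      by (simp add: algebra_simps)
    then show ?thesis using m1 cs tr by simp
  qed
  have cs': "complex_of_real c * complex_of_real c + complex_of_real s * complex_of_real s = 1"
    using cs by (metis of_real_1 of_real_add of_real_mult power2_eq_square)
  have two: "{0..<2::nat} = {0, Suc 0}" by auto
  have "mat_adjoint U * U = 1\<^sub>m 2"
    by (rule eq_mat_2I; use U mult_carrier_mat[OF V U] cs' in
      \<open>simp add: scalar_prod_def mat_adjoint_index[OF U] ent two algebra_simps\<close>)
  moreover have "sym_mat2 a b d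
      = U * mat_diag 2 (\<lambda>i. complex_of_real (if i = 0 then l else m)) * mat_adjoint U"
    unfolding mat_diag_mult_right[OF U] m1[symmetric] m2[symmetric] m3[symmetric]
    by (rule eq_mat_2I; use U mult_carrier_mat[OF mat_carrier V] in
      \<open>simp add: mat_of_rows_list_2_carrier scalar_prod_def mat_adjoint_index[OF U] ent
         two algebra_simps power2_eq_square\<close>)
  ultimately show thesis using U that by blast
qed

section \<open>Norms and singular values in dimension 2, read off from trace and determinant\<close>

lemma schatten_norm_sym_mat2:
  assumes "l + m = a + d" "l * m = a * d - b\<^sup>2" "p \<noteq> 0"
  shows "schatten_norm p (sym_mat2 a b d) powr p = \<bar>l\<bar> powr p + \<bar>m\<bar> powr p"
proof -
  obtain U where "U \<in> carrier_mat 2 2" "mat_adjoint U * U = 1\<^sub>m 2"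
    "sym_mat2 a b d = U * mat_diag 2 (\<lambda>i. complex_of_real (if i = 0 then l else m)) * mat_adjoint U"
    using sym_mat2_diagonalization[OF assms(1,2)] .
  from schatten_norm_hermitian[OF this sym_mat2_adjoint assms(3)] show ?thesis
    by (simp add: numeral_2_eq_2)
qed

lemma singular_values_sym_mat2:
  assumes "l + m = a + d" "l * m = a * d - b\<^sup>2"
  shows "singular_values (sym_mat2 a b d) = {#\<bar>l\<bar>, \<bar>m\<bar>#}"
proof -
  obtain U where "U \<in> carrier_mat 2 2" "mat_adjoint U * U = 1\<^sub>m 2"
    "sym_mat2 a b d = U * mat_diag 2 (\<lambda>i. complex_of_real (if i = 0 then l else m)) * mat_adjoint U"
    using sym_mat2_diagonalization[OF assms(1,2)] .
  from singular_values_hermitian[OF this sym_mat2_adjoint] show ?thesis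
    by (simp add: numeral_2_eq_2)
qed

lemma sigma_sym_mat2:
  assumes "l + m = a + d" "l * m = a * d - b\<^sup>2" "\<bar>m\<bar> \<le> \<bar>l\<bar>"
  shows "sigma_down (sym_mat2 a b d) = vec_of_list [\<bar>l\<bar>, \<bar>m\<bar>]"
    and "sigma_up (sym_mat2 a b d) = vec_of_list [\<bar>m\<bar>, \<bar>l\<bar>]"
  using assms(3) by (auto simp: sigma_down_def sigma_up_def singular_values_sym_mat2[OF assms(1,2)])

lemma vec_lp_norm_2:
  assumes "p \<noteq> 0"
  shows "vec_lp_norm p (vec_of_list [x, y] + vec_of_list [u, v]) powr p
           = \<bar>x + u\<bar> powr p + \<bar>y + v\<bar> powr p"
    and "vec_lp_norm p (vec_of_list [x, y] - vec_of_list [u, v]) powr p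
           = \<bar>x - u\<bar> powr p + \<bar>y - v\<bar> powr p"
  using assms by (simp_all add: vec_lp_norm_def numeral_2_eq_2 powr_powr)

section \<open>Numerical verification at the exponents 1 and 3\<close>

theorem mainTheorem7:
  fixes C D :: "complex mat"
  assumes C: "C = mat_of_rows_list 2 [[6, 0], [0, -1]]"
    and D: "D = mat_of_rows_list 2 [[-1.97035, 1.72243], [1.72243, 1.79035]]"
  shows "(\<exists>p::real. 1 \<le> p \<and> p \<le> 2 \<and>
            schatten_norm p (C + D) powr p + schatten_norm p (C - D) powr p
              < vec_lp_norm p (sigma_down C + sigma_down D) powr p
                + vec_lp_norm p (sigma_down C - sigma_down D) powr p) \<and>
         (\<exists>p::real. 2 \<le> p \<and> p \<le> 3 \<and>
            schatten_norm p (C + D) powr p + schatten_norm p (C - D) powr p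
              < vec_lp_norm p (sigma_up C + sigma_down D) powr p
                + vec_lp_norm p (sigma_up C - sigma_down D) powr p) \<and>
         \<not> conjecture1_for C D \<and> \<not> conjecture2_for C D \<and>
         \<not> conjecture1 \<and> \<not> conjecture2"
proof -
  have C': "C = sym_mat2 6 0 (-1)" and D': "D = sym_mat2 (-1.97035) 1.72243 1.79035"
    by (simp_all add: C D)
  have carr: "C \<in> carrier_mat 2 2" "D \<in> carrier_mat 2 2"
    unfolding C D by (rule mat_of_rows_list_2_carrier)+
  have CpD: "C + D = sym_mat2 4.02965 1.72243 0.79035"
    by (rule eq_mat_2I; use carr in \<open>simp add: minus_carrier_mat mat_of_rows_list_2_carrier\<close>; simp add: C D)
  have CmD: "C - D = sym_mat2 7.97035 (-1.72243) (-2.79035)"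
    by (rule eq_mat_2I; use carr in \<open>simp add: minus_carrier_mat mat_of_rows_list_2_carrier\<close>; simp add: C D)
  \<comment> \<open>half the eigenvalue gaps of D, C + D and C - D\<close>
  define r where "r = sqrt (1.88035\<^sup>2 + 1.72243\<^sup>2)"
  define t where "t = sqrt (1.61965\<^sup>2 + 1.72243\<^sup>2)"
  define w where "w = sqrt (5.38035\<^sup>2 + 1.72243\<^sup>2)"
  have r2: "r * r = 1.88035\<^sup>2 + 1.72243\<^sup>2" and t2: "t * t = 1.61965\<^sup>2 + 1.72243\<^sup>2"
    and w2: "w * w = 5.38035\<^sup>2 + 1.72243\<^sup>2" by (simp_all add: r_def t_def w_def)
  \<comment> \<open>These coarse rational bounds fix the signs inside all absolute values below
    (\<open>t\<close> < 2.41, \<open>w\<close> > 2.59, 1.09 < \<open>r\<close> < 5.91) and leave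
    enough slack for both inequalities.\<close>
  have r: "2.549 \<le> r" "r \<le> 2.56"
    unfolding r_def by (rule real_le_rsqrt real_le_lsqrt; simp add: power2_eq_square)+
  have t: "2.3 \<le> t" "t \<le> 2.4"
    unfolding t_def by (rule real_le_rsqrt real_le_lsqrt; simp add: power2_eq_square)+
  have w: "5.6 \<le> w" "w \<le> 5.65"
    unfolding w_def by (rule real_le_rsqrt real_le_lsqrt; simp add: power2_eq_square)+
  have SC: "sigma_down C = vec_of_list [6, 1]" "sigma_up C = vec_of_list [1, 6]"
    using sigma_sym_mat2[of 6 "-1" 6 "-1" 0] by (simp_all add: C')
  \<comment> \<open>\<open>D\<close> has trace -0.18, hence eigenvalues -0.09 - r and -0.09 + r; the
    negative one has the larger modulus and comes first.\<close>
  have SD: "sigma_down D = vec_of_list [r + 0.09, r - 0.09]"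
    using sigma_sym_mat2(1)[of "- 0.09 - r" "r - 0.09" "-1.97035" "1.79035" "1.72243"] r r2
    by (simp add: D' algebra_simps power2_eq_square)
  \<comment> \<open>2.41 and, in \<open>M\<close>, 2.59 are half the traces of \<open>C + D\<close>
    and \<open>C - D\<close>.\<close>
  have P: "schatten_norm p (C + D) powr p = \<bar>2.41 + t\<bar> powr p + \<bar>2.41 - t\<bar> powr p" if "p \<noteq> 0" for p
    unfolding CpD by (rule schatten_norm_sym_mat2[OF _ _ that])
      (use t2 in \<open>simp_all add: algebra_simps power2_eq_square\<close>)
  have M: "schatten_norm p (C - D) powr p = \<bar>2.59 + w\<bar> powr p + \<bar>2.59 - w\<bar> powr p" if "p \<noteq> 0" for p
    unfolding CmD by (rule schatten_norm_sym_mat2[OF _ _ that])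
      (use w2 in \<open>simp_all add: algebra_simps power2_eq_square\<close>)
  \<comment> \<open>With the signs known, the left side is 4.82 + 2w and the right side is (7 + 2r)
    + 4.82, so the claim is w < r + 3.5.\<close>
  have one: "schatten_norm 1 (C + D) powr 1 + schatten_norm 1 (C - D) powr 1
      < vec_lp_norm 1 (sigma_down C + sigma_down D) powr 1
        + vec_lp_norm 1 (sigma_down C - sigma_down D) powr 1"
    unfolding P[OF one_neq_zero] M[OF one_neq_zero] SC SD vec_lp_norm_2[OF one_neq_zero]
    using r t w by simp
  have three: "schatten_norm 3 (C + D) powr 3 + schatten_norm 3 (C - D) powr 3
      < vec_lp_norm 3 (sigma_up C + sigma_down D) powr 3
        + vec_lp_norm 3 (sigma_up C - sigma_down D) powr 3"
  proof -
    have n3: "(3::real) \<noteq> 0" by simp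
    have "schatten_norm 3 (C + D) powr 3 + schatten_norm 3 (C - D) powr 3
        = (2.41 + t) ^ 3 + (2.41 - t) ^ 3 + (2.59 + w) ^ 3 + (w - 2.59) ^ 3"
      using t w by (simp add: P[OF n3] M[OF n3])
    \<comment> \<open>Only even powers of \<open>t\<close> and odd powers of \<open>w\<close>
      survive. Since the squares of both are rational, this is linear in \<open>w\<close> with
      positive coefficients, and the upper bound on \<open>w\<close> suffices.\<close>
    also have "\<dots> = 2 * 2.41 ^ 3 + 6 * 2.41 * (t * t) + 2 * w * (w * w) + 6 * 2.59\<^sup>2 * w"
      by (simp add: power2_eq_square power3_eq_cube algebra_simps
          add_divide_distrib diff_divide_distrib)
    \<comment> \<open>2.63 and 2.45 are rational lower bounds for the singular values r + 0.09 and r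
      - 0.09 of \<open>D\<close>; the right side increases with both.\<close>
    also have "\<dots> < 2 * 2.63 ^ 3 + 6 * 2.63 + 432 + 36 * 2.45\<^sup>2"
      unfolding t2 w2 using w(2) by (simp add: power2_eq_square power3_eq_cube)
    also have "\<dots> \<le> 2 * (r + 0.09) ^ 3 + 6 * (r + 0.09) + 432 + 36 * (r - 0.09)\<^sup>2"
      using r by (intro add_mono mult_left_mono power_mono) auto
    also have "\<dots> = (1 + (r + 0.09)) ^ 3 + ((r + 0.09) - 1) ^ 3
        + (6 + (r - 0.09)) ^ 3 + (6 - (r - 0.09)) ^ 3"
      by (simp add: power2_eq_square power3_eq_cube algebra_simps
          add_divide_distrib diff_divide_distrib)
    also have "\<dots> = vec_lp_norm 3 (sigma_up C + sigma_down D) powr 3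
        + vec_lp_norm 3 (sigma_up C - sigma_down D) powr 3"
      unfolding SC SD vec_lp_norm_2[OF n3] using r by simp
    finally show ?thesis .
  qed
  \<comment> \<open>The exponent 1 contradicts the first conjecture in its range up to 2, while the
    exponent 3 contradicts the second one in its reversed range above 2.\<close>
  have c1: "\<not> conjecture1_for C D"
    using one unfolding conjecture1_for_def schatten_side_def down_down_side_def
    by (metis order_refl one_le_numeral not_le)
  have c2: "\<not> conjecture2_for C D"
    using three unfolding conjecture2_for_def schatten_side_def up_down_side_def
    by (auto intro!: exI[of _ "3::real"])
  have ex_one: "\<exists>p::real. 1 \<le> p \<and> p \<le> 2 \<and>
      schatten_norm p (C + D) powr p + schatten_norm p (C - D) powr p
        < vec_lp_norm p (sigma_down C + sigma_down D) powr p
          + vec_lp_norm p (sigma_down C - sigma_down D) powr p"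
    by (rule exI[of _ 1], intro conjI one) simp_all
  have ex_three: "\<exists>p::real. 2 \<le> p \<and> p \<le> 3 \<and>
      schatten_norm p (C + D) powr p + schatten_norm p (C - D) powr p
        < vec_lp_norm p (sigma_up C + sigma_down D) powr p
          + vec_lp_norm p (sigma_up C - sigma_down D) powr p"
    by (rule exI[of _ 3], intro conjI three) simp_all
  have "\<not> conjecture1" "\<not> conjecture2"
    using c1 c2 carr unfolding conjecture1_def conjecture2_def by blast+
  with ex_one ex_three c1 c2 show ?thesis by blast
qed

end
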